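(* Let $\mathcal Q(C_a,C_b)$ be an HGP code of length $n$ (taken from a sequence of HGP codes satisfying the scaling assumptions in the context, and with logical Pauli operators given by SLT bases). For every logical qubit $(i,h,L)$ of the left sector there exists a Clifford circuit $\mathsf C$ with support size $\chi(\mathsf C)=\Theta(\sqrt n)$ and depth $\delta(\mathsf C)=\Theta(\sqrt n)$ that implements the single-qubit targeted logical Phase gate $\overline S_{i,h,L}$.
   Context: All vectors are row vectors over $\mathbb F_2$; $e_i$ denotes a standard basis vector. Given binary matrices $H_a$ ($m_a\times n_a$), $H_b$ ($m_b\times n_b$), parity-check matrices of classical codes $C_a=\ker H_a$, $C_b=\ker H_b$, the hypergraph product (HGP) code $\mathcal Q(C_a,C_b)$ is the CSS code on $n=n_an_b+m_am_b$ qubits with $$H_X=[H_a\otimes I_{n_b}\,|\,I_{m_a}\otimes H_b^{\top}],\qquad H_Z=[I_{n_a}\otimes H_b\,|\,H_a^{\top}\otimes I_{m_b}].$$ Its stabilizer generators are the $X$-type Pauli operators supported on the rows of $H_X$ and the $Z$-type Pauli operators supported on the rows of $H_Z$. The first $n_an_b$ qubits form the left sector and the remaining ones the right sector. An SLT basis of a subspace is a basis $\{a_i\}$ indexed by distinct coordinates $i$ (pivots) such that $(a_i)_i=1$ and $(a_{i'})_i=0$ for pivots $i'\ne i$. Let $\{a_i\},\{\alpha_j\},\{b_h\},\{\beta_l\}$ be SLT bases of $\ker H_a,\ker H_a^{\top},\ker H_b,\ker H_b^{\top}$. Logical qubits are labelled $(i,h,L)$ ($i,h$ pivots of $\{a_i\},\{b_h\}$)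 and $(j,l,R)$ ($j,l$ pivots of $\{\alpha_j\},\{\beta_l\}$). Logical Paulis: $\overline X_{i,h,L}$ is the $X$-type operator with support vector $[e_i\otimes b_h|0]$, $\overline Z_{i,h,L}$ the $Z$-type operator with $[a_i\otimes e_h|0]$, $\overline X_{j,l,R}$ the $X$-type operator with $[0|\alpha_j\otimes e_l]$, $\overline Z_{j,l,R}$ the $Z$-type operator with $[0|e_j\otimes\beta_l]$. Scaling assumptions: a sequence of HGP codes with $n\to\infty$, where $n_a,n_b$ scale in proportion to $\sqrt n$ and the dimensions and distances of the constituent codes are a constant proportion of their lengths, so that the Hamming weights of all vectors in the four SLT bases are $\Theta(\sqrt n)$ (uniformly). A Clifford circuit $\mathsf C$ is a finite sequence of one- and two-qubit gates on the $n$ physical qubits from $\{H,S,CNOT,CZ,SWAP\}$ and single-qubit Paulis (no ancillas), enacting a unitary $U$. Its support is the smallest set of qubits such that $U$ acts as the identity on every qubit outside it, with size $\chi(\mathsf C)$; its depth $\delta(\mathsf C)$ is the minimum number of layers into which its gates can be arranged so that gates in the same layer do not overlap on qubits. $\mathsf C$ implements a logical gate $g$ if $USU^\dagger=S$ for every stabilizer generator $S$ and conjugation by $U$ acts on the logical Paulis as $g$ prescribes, up to global phases of logical Paulis. $\overline S_{i,h,L}$ maps $\overline X_{i,h,L}\mapsto\overline X_{i,h,L}\overline Z_{i,h,L}$ and fixes all other logical Paulis $\overline X,\overline Z$. *)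

theory Defs
  imports
    Complex_Main
    "HOL-Library.Z2"
    "HOL-Library.Landau_Symbols"
    "Jordan_Normal_Form.Matrix_Kernel"
    "Jordan_Normal_Form.Schur_Decomposition"
begin

section \<open>Binary linear algebra\<close>

definition kron_mat :: "'a :: semiring_0 mat \<Rightarrow> 'a mat \<Rightarrow> 'a mat" where
  "kron_mat A B = mat (dim_row A * dim_row B) (dim_col A * dim_col B)
     (\<lambda>(r, c). A $$ (r div dim_row B, c div dim_col B) * B $$ (r mod dim_row B, c mod dim_col B))"

definition kron_vec :: "'a :: semiring_0 vec \<Rightarrow> 'a vec \<Rightarrow> 'a vec" where
  "kron_vec u v = vec (dim_vec u * dim_vec v) (\<lambda>k. u $ (k div dim_vec v) * v $ (k mod dim_vec v))"

definition append_cols :: "'a :: zero mat \<Rightarrow> 'a mat \<Rightarrow> 'a mat" where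
  "append_cols A B = four_block_mat A B (0\<^sub>m 0 (dim_col A)) (0\<^sub>m 0 (dim_col B))"

definition hamming_weight :: "bit vec \<Rightarrow> nat" where
  "hamming_weight v = card {k. k < dim_vec v \<and> v $ k \<noteq> 0}"

text \<open>The minimum distance of \<open>mat_kernel H\<close>; it is unspecified for the zero code.\<close>

definition code_distance :: "bit mat \<Rightarrow> nat" where
  "code_distance H =
     (LEAST d. \<exists>v \<in> mat_kernel H. v \<noteq> 0\<^sub>v (dim_col H) \<and> hamming_weight v = d)"

text \<open>An SLT basis of \<open>mat_kernel H\<close> is a partial map whose domain is the set of pivots and
  whose range is the set of basis vectors.\<close>

definition slt_basis :: "bit mat \<Rightarrow> (nat \<rightharpoonup> bit vec) \<Rightarrow> bool" where
  "slt_basis H a \<longleftrightarrow>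
     dom a \<subseteq> {..<dim_col H} \<and>
     kernel.basis (dim_col H) H (ran a) \<and>
     (\<forall>i \<in> dom a. the (a i) $ i = 1) \<and>
     (\<forall>i \<in> dom a. \<forall>i' \<in> dom a. i' \<noteq> i \<longrightarrow> the (a i') $ i = 0)"


section \<open>Operators on \<open>n\<close> qubits\<close>

text \<open>Operators on \<open>n\<close> qubits are complex matrices of size \<open>2 ^ n\<close>: the computational basis state
  with index \<open>c\<close> has qubit \<open>k\<close> in the state given by binary digit \<open>k\<close> of \<open>c\<close>.\<close>

definition tensor_op :: "nat \<Rightarrow> (nat \<Rightarrow> complex mat) \<Rightarrow> complex mat" where
  "tensor_op n G = mat (2 ^ n) (2 ^ n)
     (\<lambda>(r, c). \<Prod>k<n. G k $$ (of_bool (bit r k), of_bool (bit c k)))"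

definition one_qubit_op :: "nat \<Rightarrow> complex mat \<Rightarrow> nat \<Rightarrow> complex mat" where
  "one_qubit_op n G q = tensor_op n (\<lambda>k. if k = q then G else 1\<^sub>m 2)"

text \<open>The \<open>4 \<times> 4\<close> matrix \<open>G\<close> is written in the basis 00, 01, 10, 11, with \<open>p\<close> the first qubit.\<close>

definition two_qubit_op :: "nat \<Rightarrow> complex mat \<Rightarrow> nat \<Rightarrow> nat \<Rightarrow> complex mat" where
  "two_qubit_op n G p q = mat (2 ^ n) (2 ^ n)
     (\<lambda>(r, c). if \<forall>k<n. k \<noteq> p \<and> k \<noteq> q \<longrightarrow> bit r k = bit c k
        then G $$ (2 * of_bool (bit r p) + of_bool (bit r q), 2 * of_bool (bit c p) + of_bool (bit c q))
        else 0)"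

definition X_mat :: "complex mat" where
  "X_mat = mat_of_rows_list 2 [[0, 1], [1, 0]]"

definition Y_mat :: "complex mat" where
  "Y_mat = mat_of_rows_list 2 [[0, -\<i>], [\<i>, 0]]"

definition Z_mat :: "complex mat" where
  "Z_mat = mat_of_rows_list 2 [[1, 0], [0, -1]]"

definition H_mat :: "complex mat" where
  "H_mat = complex_of_real (1 / sqrt 2) \<cdot>\<^sub>m mat_of_rows_list 2 [[1, 1], [1, -1]]"

definition S_mat :: "complex mat" where
  "S_mat = mat_of_rows_list 2 [[1, 0], [0, \<i>]]"

definition CNOT_mat :: "complex mat" where
  "CNOT_mat = mat_of_rows_list 4 [[1, 0, 0, 0], [0, 1, 0, 0], [0, 0, 0, 1], [0, 0, 1, 0]]"

definition CZ_mat :: "complex mat" where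
  "CZ_mat = mat_of_rows_list 4 [[1, 0, 0, 0], [0, 1, 0, 0], [0, 0, 1, 0], [0, 0, 0, -1]]"

definition SWAP_mat :: "complex mat" where
  "SWAP_mat = mat_of_rows_list 4 [[1, 0, 0, 0], [0, 0, 1, 0], [0, 1, 0, 0], [0, 0, 0, 1]]"

text \<open>The \<open>X\<close>-type and \<open>Z\<close>-type Pauli operators with a given support vector.\<close>

definition pauli_X :: "bit vec \<Rightarrow> complex mat" where
  "pauli_X v = tensor_op (dim_vec v) (\<lambda>k. if v $ k = 1 then X_mat else 1\<^sub>m 2)"

definition pauli_Z :: "bit vec \<Rightarrow> complex mat" where
  "pauli_Z v = tensor_op (dim_vec v) (\<lambda>k. if v $ k = 1 then Z_mat else 1\<^sub>m 2)"


section \<open>Clifford circuits\<close>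

datatype gate =
    Hadamard nat | Phase nat | PauliX nat | PauliY nat | PauliZ nat
  | CNOT nat nat | CZ nat nat | SWAP nat nat

fun gate_qubits :: "gate \<Rightarrow> nat set" where
  "gate_qubits (Hadamard q) = {q}"
| "gate_qubits (Phase q) = {q}"
| "gate_qubits (PauliX q) = {q}"
| "gate_qubits (PauliY q) = {q}"
| "gate_qubits (PauliZ q) = {q}"
| "gate_qubits (CNOT p q) = {p, q}"
| "gate_qubits (CZ p q) = {p, q}"
| "gate_qubits (SWAP p q) = {p, q}"

fun gate_op :: "nat \<Rightarrow> gate \<Rightarrow> complex mat" where
  "gate_op n (Hadamard q) = one_qubit_op n H_mat q"
| "gate_op n (Phase q) = one_qubit_op n S_mat q"
| "gate_op n (PauliX q) = one_qubit_op n X_mat q"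
| "gate_op n (PauliY q) = one_qubit_op n Y_mat q"
| "gate_op n (PauliZ q) = one_qubit_op n Z_mat q"
| "gate_op n (CNOT p q) = two_qubit_op n CNOT_mat p q"
| "gate_op n (CZ p q) = two_qubit_op n CZ_mat p q"
| "gate_op n (SWAP p q) = two_qubit_op n SWAP_mat p q"

fun valid_gate :: "nat \<Rightarrow> gate \<Rightarrow> bool" where
  "valid_gate n (CNOT p q) \<longleftrightarrow> p < n \<and> q < n \<and> p \<noteq> q"
| "valid_gate n (CZ p q) \<longleftrightarrow> p < n \<and> q < n \<and> p \<noteq> q"
| "valid_gate n (SWAP p q) \<longleftrightarrow> p < n \<and> q < n \<and> p \<noteq> q"
| "valid_gate n g \<longleftrightarrow> gate_qubits g \<subseteq> {..<n}"

definition clifford_circuit :: "nat \<Rightarrow> gate list \<Rightarrow> bool" where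
  "clifford_circuit n C \<longleftrightarrow> (\<forall>g \<in> set C. valid_gate n g)"

text \<open>The head of the list is the gate applied first.\<close>

primrec circuit_unitary :: "nat \<Rightarrow> gate list \<Rightarrow> complex mat" where
  "circuit_unitary n [] = 1\<^sub>m (2 ^ n)"
| "circuit_unitary n (g # C) = circuit_unitary n C * gate_op n g"

text \<open>\<open>U\<close> is the tensor product of the identity on qubit \<open>q\<close> with an operator on the
  remaining qubits, whose matrix entries are given by \<open>V\<close>.\<close>

definition acts_as_identity_on :: "nat \<Rightarrow> complex mat \<Rightarrow> nat \<Rightarrow> bool" where
  "acts_as_identity_on n U q \<longleftrightarrow>
     (\<exists>V :: nat \<Rightarrow> nat \<Rightarrow> complex. \<forall>r < 2 ^ n. \<forall>c < 2 ^ n.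
        U $$ (r, c) = (if bit r q = bit c q then V (unset_bit q r) (unset_bit q c) else 0))"

text \<open>\<open>Least\<close> refers to the inclusion order on sets.\<close>

definition circuit_support :: "nat \<Rightarrow> gate list \<Rightarrow> nat set" where
  "circuit_support n C =
     (LEAST A. A \<subseteq> {..<n} \<and> (\<forall>q<n. q \<notin> A \<longrightarrow> acts_as_identity_on n (circuit_unitary n C) q))"

lemma circuit_support_eq:
  "circuit_support n C = {q. q < n \<and> \<not> acts_as_identity_on n (circuit_unitary n C) q}"
  unfolding circuit_support_def by (rule Least_equality) auto

definition support_size :: "nat \<Rightarrow> gate list \<Rightarrow> nat" where
  "support_size n C = card (circuit_support n C)"

text \<open>A layering assigns a layer to each gate of the circuit; gates acting on a common qubit are in
  different layers and keep their order.\<close>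

definition layering :: "gate list \<Rightarrow> nat \<Rightarrow> (nat \<Rightarrow> nat) \<Rightarrow> bool" where
  "layering C d l \<longleftrightarrow>
     (\<forall>j < length C. l j < d) \<and>
     (\<forall>j < length C. \<forall>k < j. gate_qubits (C ! k) \<inter> gate_qubits (C ! j) \<noteq> {} \<longrightarrow> l k < l j)"

definition circuit_depth :: "gate list \<Rightarrow> nat" where
  "circuit_depth C = (LEAST d. \<exists>l. layering C d l)"

lemma layering_circuit_depth: "\<exists>l. layering C (circuit_depth C) l"
  unfolding circuit_depth_def
  by (rule LeastI[of _ "length C"]) (auto simp: layering_def intro!: exI[of _ "\<lambda>j. j"])


section \<open>Hypergraph product codes with SLT bases\<close>

text \<open>\<open>slt_aT\<close> and \<open>slt_bT\<close> are the bases of the kernels of the transposed check matrices.\<close>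

record hgp_code =
  check_a :: "bit mat"
  check_b :: "bit mat"
  slt_a :: "nat \<rightharpoonup> bit vec"
  slt_aT :: "nat \<rightharpoonup> bit vec"
  slt_b :: "nat \<rightharpoonup> bit vec"
  slt_bT :: "nat \<rightharpoonup> bit vec"

abbreviation len_a :: "hgp_code \<Rightarrow> nat" where "len_a Q \<equiv> dim_col (check_a Q)"
abbreviation len_b :: "hgp_code \<Rightarrow> nat" where "len_b Q \<equiv> dim_col (check_b Q)"
abbreviation checks_a :: "hgp_code \<Rightarrow> nat" where "checks_a Q \<equiv> dim_row (check_a Q)"
abbreviation checks_b :: "hgp_code \<Rightarrow> nat" where "checks_b Q \<equiv> dim_row (check_b Q)"

definition has_slt_bases :: "hgp_code \<Rightarrow> bool" where
  "has_slt_bases Q \<longleftrightarrow>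
     slt_basis (check_a Q) (slt_a Q) \<and> slt_basis (transpose_mat (check_a Q)) (slt_aT Q) \<and>
     slt_basis (check_b Q) (slt_b Q) \<and> slt_basis (transpose_mat (check_b Q)) (slt_bT Q)"

definition num_qubits :: "hgp_code \<Rightarrow> nat" where
  "num_qubits Q = len_a Q * len_b Q + checks_a Q * checks_b Q"

definition hgp_HX :: "hgp_code \<Rightarrow> bit mat" where
  "hgp_HX Q = append_cols (kron_mat (check_a Q) (1\<^sub>m (len_b Q)))
                          (kron_mat (1\<^sub>m (checks_a Q)) (transpose_mat (check_b Q)))"

definition hgp_HZ :: "hgp_code \<Rightarrow> bit mat" where
  "hgp_HZ Q = append_cols (kron_mat (1\<^sub>m (len_a Q)) (check_b Q))
                          (kron_mat (transpose_mat (check_a Q)) (1\<^sub>m (checks_b Q)))"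

definition stabilizer_generators :: "hgp_code \<Rightarrow> complex mat set" where
  "stabilizer_generators Q =
     {pauli_X (row (hgp_HX Q) r) | r. r < dim_row (hgp_HX Q)} \<union>
     {pauli_Z (row (hgp_HZ Q) r) | r. r < dim_row (hgp_HZ Q)}"

datatype logical_qubit = LeftSector nat nat | RightSector nat nat

datatype logical_pauli = LogicalX logical_qubit | LogicalZ logical_qubit

definition logical_qubits :: "hgp_code \<Rightarrow> logical_qubit set" where
  "logical_qubits Q =
     {LeftSector i h | i h. i \<in> dom (slt_a Q) \<and> h \<in> dom (slt_b Q)} \<union>
     {RightSector j l | j l. j \<in> dom (slt_aT Q) \<and> l \<in> dom (slt_bT Q)}"

definition logical_paulis :: "hgp_code \<Rightarrow> logical_pauli set" where
  "logical_paulis Q = LogicalX ` logical_qubits Q \<union> LogicalZ ` logical_qubits Q"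

definition left_vec :: "hgp_code \<Rightarrow> bit vec \<Rightarrow> bit vec" where
  "left_vec Q v = v @\<^sub>v 0\<^sub>v (checks_a Q * checks_b Q)"

definition right_vec :: "hgp_code \<Rightarrow> bit vec \<Rightarrow> bit vec" where
  "right_vec Q v = 0\<^sub>v (len_a Q * len_b Q) @\<^sub>v v"

fun logical_op :: "hgp_code \<Rightarrow> logical_pauli \<Rightarrow> complex mat" where
  "logical_op Q (LogicalX (LeftSector i h)) =
     pauli_X (left_vec Q (kron_vec (unit_vec (len_a Q) i) (the (slt_b Q h))))"
| "logical_op Q (LogicalZ (LeftSector i h)) =
     pauli_Z (left_vec Q (kron_vec (the (slt_a Q i)) (unit_vec (len_b Q) h)))"
| "logical_op Q (LogicalX (RightSector j l)) =
     pauli_X (right_vec Q (kron_vec (the (slt_aT Q j)) (unit_vec (checks_b Q) l)))"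
| "logical_op Q (LogicalZ (RightSector j l)) =
     pauli_Z (right_vec Q (kron_vec (unit_vec (checks_a Q) j) (the (slt_bT Q l))))"

definition logical_product :: "hgp_code \<Rightarrow> logical_pauli list \<Rightarrow> complex mat" where
  "logical_product Q Ps = foldr (\<lambda>P M. logical_op Q P * M) Ps (1\<^sub>m (2 ^ num_qubits Q))"

text \<open>A logical gate is prescribed by the image of every logical Pauli, given as a product of
  logical Paulis. Each of these images only matters up to its own phase, whereas the stabilizer
  generators have to be fixed exactly.\<close>

definition implements_logical_gate ::
  "hgp_code \<Rightarrow> gate list \<Rightarrow> (logical_pauli \<Rightarrow> logical_pauli list) \<Rightarrow> bool" where
  "implements_logical_gate Q C g \<longleftrightarrow>
     (let U = circuit_unitary (num_qubits Q) C in
       (\<forall>S \<in> stabilizer_generators Q. U * S * mat_adjoint U = S) \<and>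
       (\<forall>P \<in> logical_paulis Q. \<exists>w :: complex. cmod w = 1 \<and>
          U * logical_op Q P * mat_adjoint U = w \<cdot>\<^sub>m logical_product Q (g P)))"

definition logical_phase_gate :: "logical_qubit \<Rightarrow> logical_pauli \<Rightarrow> logical_pauli list" where
  "logical_phase_gate k P = (if P = LogicalX k then [LogicalX k, LogicalZ k] else [P])"


section \<open>Asymptotics\<close>

text \<open>\<open>f t k\<close> is \<open>\<Theta>(g t)\<close> as \<open>t \<rightarrow> \<infinity>\<close>, with constants that do not depend on \<open>k \<in> K t\<close>.\<close>

definition uniformly_bigtheta :: "(nat \<Rightarrow> 'k set) \<Rightarrow> (nat \<Rightarrow> 'k \<Rightarrow> nat) \<Rightarrow> (nat \<Rightarrow> real) \<Rightarrow> bool" where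
  "uniformly_bigtheta K f g \<longleftrightarrow>
     (\<exists>c>0. \<exists>C>0. eventually (\<lambda>t. \<forall>k \<in> K t.
        c * \<bar>g t\<bar> \<le> real (f t k) \<and> real (f t k) \<le> C * \<bar>g t\<bar>) sequentially)"

definition scaling_assumptions :: "(nat \<Rightarrow> hgp_code) \<Rightarrow> bool" where
  "scaling_assumptions Q \<longleftrightarrow>
     (let root_n = (\<lambda>t. sqrt (real (num_qubits (Q t)))) in
       filterlim (\<lambda>t. num_qubits (Q t)) at_top sequentially \<and>
       (\<lambda>t. real (len_a (Q t))) \<in> \<Theta>(root_n) \<and>
       (\<lambda>t. real (len_b (Q t))) \<in> \<Theta>(root_n) \<and>
       (\<lambda>t. real (kernel_dim (check_a (Q t)))) \<in> \<Theta>(\<lambda>t. real (len_a (Q t))) \<and>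
       (\<lambda>t. real (kernel_dim (check_b (Q t)))) \<in> \<Theta>(\<lambda>t. real (len_b (Q t))) \<and>
       (\<lambda>t. real (code_distance (check_a (Q t)))) \<in> \<Theta>(\<lambda>t. real (len_a (Q t))) \<and>
       (\<lambda>t. real (code_distance (check_b (Q t)))) \<in> \<Theta>(\<lambda>t. real (len_b (Q t))) \<and>
       uniformly_bigtheta (\<lambda>t. ran (slt_a (Q t))) (\<lambda>t. hamming_weight) root_n \<and>
       uniformly_bigtheta (\<lambda>t. ran (slt_aT (Q t))) (\<lambda>t. hamming_weight) root_n \<and>
       uniformly_bigtheta (\<lambda>t. ran (slt_b (Q t))) (\<lambda>t. hamming_weight) root_n \<and>
       uniformly_bigtheta (\<lambda>t. ran (slt_bT (Q t))) (\<lambda>t. hamming_weight) root_n)"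

end

theory Submission
  imports Defs
begin

text \<open>
  Let \<open>A\<close> be the support of the logical \<open>Z\<close> of the targeted qubit. The diagonal unitary that
  multiplies a basis state by \<open>\<i>\<close> exactly if its restriction to \<open>A\<close> has odd parity commutes with
  every \<open>Z\<close>-type Pauli operator, fixes the \<open>X\<close>-type operators that meet \<open>A\<close> in an even number of
  qubits, and sends the others from \<open>X\<close> to \<open>\<i> X Z\<close>, where \<open>Z\<close> is supported on \<open>A\<close>. The stabilizer
  generators and all logical \<open>X\<close> but the targeted one have even overlap with \<open>A\<close>. The unitary is
  obtained by accumulating the parity of \<open>A\<close> on the pivot qubit with CNOTs, applying a Phase gate
  there and undoing the CNOTs. The support of the circuit is \<open>A\<close>, and as every gate acts on the pivot
  its depth is its length \<open>2 |A| - 1\<close>, where \<open>|A|\<close> is the weight of an SLT basis vector.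
\<close>

section \<open>Pauli operators in the computational basis\<close>

definition support :: "bit vec \<Rightarrow> nat set" where
  "support v = {k. k < dim_vec v \<and> v $ k = 1}"

definition parity :: "nat set \<Rightarrow> nat \<Rightarrow> bit" where
  "parity A c = (\<Sum>k\<in>A. of_bool (bit c k))"

text \<open>For \<open>A\<close> inside \<open>{..<n}\<close> this is the square root (1 +
  \<open>\<i>\<close>)/2 + (1 - \<open>\<i>\<close>)/2 P of the \<open>Z\<close>-type Pauli operator
  P supported on \<open>A\<close>.\<close>

definition parity_phase_op :: "nat \<Rightarrow> nat set \<Rightarrow> complex mat" where
  "parity_phase_op n A = mat_diag (2 ^ n) (\<lambda>c. if parity A c = 1 then \<i> else 1)"

lemma finite_support [simp]: "finite (support v)"
  by (simp add: support_def)

lemma support_less: "k \<in> support v \<Longrightarrow> k < dim_vec v"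
  by (simp add: support_def)

lemma card_support: "card (support v) = hamming_weight v"
  by (simp add: support_def hamming_weight_def)

lemma bits_eq_imp_eq:
  fixes r c :: nat
  assumes "r < 2 ^ n" "c < 2 ^ n" "\<And>k. k < n \<Longrightarrow> bit r k = bit c k"
  shows "r = c"
proof -
  have "take_bit n r = take_bit n c"
    by (rule bit_eqI) (auto simp: bit_take_bit_iff assms(3))
  then show ?thesis
    using assms(1,2) by (simp add: take_bit_nat_eq_self)
qed

lemma gate_mat_index [simp]:
  "X_mat $$ (0, 0) = 0" "X_mat $$ (0, Suc 0) = 1" "X_mat $$ (Suc 0, 0) = 1" "X_mat $$ (Suc 0, Suc 0) = 0"
  "Z_mat $$ (0, 0) = 1" "Z_mat $$ (0, Suc 0) = 0" "Z_mat $$ (Suc 0, 0) = 0" "Z_mat $$ (Suc 0, Suc 0) = -1"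
  "S_mat $$ (0, 0) = 1" "S_mat $$ (0, Suc 0) = 0" "S_mat $$ (Suc 0, 0) = 0" "S_mat $$ (Suc 0, Suc 0) = \<i>"
  by (simp_all add: X_mat_def Z_mat_def S_mat_def mat_of_rows_list_def)

text \<open>Each tensor factor is \<open>X_mat\<close> or the identity, so its entry is 1 or 0
  according to whether the two bits differ exactly when \<open>v\<close> selects that qubit. The
  product of these indicators is the indicator of the conjunction.\<close>

lemma pauli_X_index:
  assumes "r < 2 ^ dim_vec v" "c < 2 ^ dim_vec v"
  shows "pauli_X v $$ (r, c) = of_bool (\<forall>k < dim_vec v. (bit r k \<noteq> bit c k) = (v $ k = 1))"
proof -
  have "pauli_X v $$ (r, c) = (\<Prod>k<dim_vec v. of_bool ((bit r k \<noteq> bit c k) = (v $ k = 1)))"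
    using assms by (auto simp: pauli_X_def tensor_op_def intro!: prod.cong)
  also have "\<dots> = of_bool (\<forall>k < dim_vec v. (bit r k \<noteq> bit c k) = (v $ k = 1))"
    by (cases "\<forall>k < dim_vec v. (bit r k \<noteq> bit c k) = (v $ k = 1)")
      (auto intro!: prod.neutral prod_zero)
  finally show ?thesis .
qed

lemma tensor_op_carrier [simp]: "tensor_op n G \<in> carrier_mat (2 ^ n) (2 ^ n)"
  by (simp add: tensor_op_def)

text \<open>Distinct indices below \<open>2 ^ n\<close> differ in some bit below \<open>n\<close>,
  and the factor at that bit is an off-diagonal entry, hence 0.\<close>

lemma tensor_op_diagonal:
  assumes "\<And>k a b. k < n \<Longrightarrow> G k $$ (of_bool a, of_bool b) = (if a = b then g k a else 0)"
  shows "tensor_op n G = mat_diag (2 ^ n) (\<lambda>c. \<Prod>k<n. g k (bit c k))"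
proof (rule eq_matI)
  fix r c :: nat
  assume "r < dim_row (mat_diag (2 ^ n) (\<lambda>c. \<Prod>k<n. g k (bit c k)))"
    and "c < dim_col (mat_diag (2 ^ n) (\<lambda>c. \<Prod>k<n. g k (bit c k)))"
  then have rc: "r < 2 ^ n" "c < 2 ^ n"
    by (simp_all add: mat_diag_def)
  have *: "tensor_op n G $$ (r, c) = (\<Prod>k<n. if bit r k = bit c k then g k (bit r k) else 0)"
    using rc assms by (auto simp: tensor_op_def intro!: prod.cong)
  show "tensor_op n G $$ (r, c) = mat_diag (2 ^ n) (\<lambda>c. \<Prod>k<n. g k (bit c k)) $$ (r, c)"
  proof (cases "r = c")
    case True
    then show ?thesis
      using rc * by (simp add: mat_diag_def)
  next
    case False
    then obtain k where "k < n" "bit r k \<noteq> bit c k"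
      using bits_eq_imp_eq[OF rc] by blast
    then show ?thesis
      using rc * False by (auto simp: mat_diag_def intro!: prod_zero)
  qed
qed (simp_all add: tensor_op_def mat_diag_def)

lemma prod_sign_eq_parity:
  assumes "finite A"
  shows "(\<Prod>k\<in>A. if bit c k then -1 else 1) = (if parity A c = 1 then -1 else (1 :: complex))"
  using assms by (induction A rule: finite_induct) (auto simp: parity_def)

lemma pauli_Z_eq_mat_diag:
  "pauli_Z v = mat_diag (2 ^ dim_vec v) (\<lambda>c. if parity (support v) c = 1 then -1 else 1)"
proof -
  have "pauli_Z v = mat_diag (2 ^ dim_vec v)
      (\<lambda>c. \<Prod>k<dim_vec v. if v $ k = 1 \<and> bit c k then -1 else 1)"
    unfolding pauli_Z_def by (rule tensor_op_diagonal) auto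
  also have "\<dots> = mat_diag (2 ^ dim_vec v) (\<lambda>c. if parity (support v) c = 1 then -1 else 1)"
  proof -
    have "(\<Prod>k<dim_vec v. if v $ k = 1 \<and> bit c k then -1 else 1) =
        (\<Prod>k\<in>support v. if bit c k then -1 else (1 :: complex))" for c :: nat
      by (rule prod.mono_neutral_cong_right) (auto simp: support_def)
    then show ?thesis
      by (simp only: prod_sign_eq_parity[OF finite_support])
  qed
  finally show ?thesis .
qed

lemma pauli_carrier:
  "pauli_X v \<in> carrier_mat (2 ^ dim_vec v) (2 ^ dim_vec v)"
  "pauli_Z v \<in> carrier_mat (2 ^ dim_vec v) (2 ^ dim_vec v)"
  by (simp_all add: pauli_X_def pauli_Z_def)

text \<open>The base case of the CNOT ladder, where the parity is that of a single qubit.\<close>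

lemma Phase_op_eq:
  assumes "q < n"
  shows "one_qubit_op n S_mat q = parity_phase_op n {q}"
proof -
  have "one_qubit_op n S_mat q =
      mat_diag (2 ^ n) (\<lambda>c. \<Prod>k<n. if k = q \<and> bit c k then \<i> else 1)"
    unfolding one_qubit_op_def by (rule tensor_op_diagonal) auto
  also have "(\<lambda>c :: nat. \<Prod>k<n. if k = q \<and> bit c k then \<i> else 1) =
      (\<lambda>c. if parity {q} c = 1 then \<i> else 1)"
  proof
    fix c :: nat
    have "(\<Prod>k<n. if k = q \<and> bit c k then \<i> else 1) =
        (\<Prod>k\<in>{q}. if bit c k then \<i> else 1)"
      using assms by (intro prod.mono_neutral_cong_right) auto
    then show "(\<Prod>k<n. if k = q \<and> bit c k then \<i> else 1) = (if parity {q} c = 1 then \<i> else 1)"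
      by (simp add: parity_def)
  qed
  finally show ?thesis
    by (simp add: parity_phase_op_def)
qed


section \<open>Conjugation by a parity-controlled phase\<close>

lemma mat_adjoint_mat_diag:
  fixes f :: "nat \<Rightarrow> complex"
  shows "mat_adjoint (mat_diag n f) = mat_diag n (\<lambda>c. cnj (f c))"
  by (rule eq_matI) (auto simp: mat_adjoint_def mat_diag_def mat_of_rows_def)

text \<open>Conjugation by a diagonal matrix only rescales entries, so its effect on a Pauli
  operator can be read off one entry at a time.\<close>

lemma mat_diag_conj_index:
  fixes f :: "nat \<Rightarrow> complex"
  assumes A: "A \<in> carrier_mat n n" and rc: "r < n" "c < n"
  shows "(mat_diag n f * A * mat_adjoint (mat_diag n f)) $$ (r, c) = f r * cnj (f c) * A $$ (r, c)"
proof -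
  have "mat_diag n f * A \<in> carrier_mat n n"
    using A by (intro mult_carrier_mat[of _ n n]) auto
  then show ?thesis
    using rc unfolding mat_adjoint_mat_diag mat_diag_mult_right[OF \<open>mat_diag n f * A \<in> carrier_mat n n\<close>]
    by (simp add: mat_diag_mult_left[OF A] mult.commute mult.left_commute)
qed

lemma mat_diag_conj_carrier:
  fixes f :: "nat \<Rightarrow> complex"
  assumes A: "A \<in> carrier_mat n n"
  shows "mat_diag n f * A * mat_adjoint (mat_diag n f) \<in> carrier_mat n n"
  unfolding mat_adjoint_mat_diag by (intro mult_carrier_mat[of _ n n] mat_diag_dim A)

text \<open>Everything here is diagonal, and the phases have modulus 1, so they cancel against their
  conjugates.\<close>

lemma parity_phase_conj_pauli_Z:
  assumes "dim_vec v = n"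
  shows "parity_phase_op n A * pauli_Z v * mat_adjoint (parity_phase_op n A) = pauli_Z v"
  unfolding parity_phase_op_def pauli_Z_eq_mat_diag assms mat_adjoint_mat_diag mat_diag_diag
  by (rule arg_cong[of _ _ "mat_diag (2 ^ n)"]) auto

text \<open>The parity of the overlap of two supports becomes an inner product over the field with
  two elements, where kernel membership and the SLT conditions apply.\<close>

lemma sum_support_eq_scalar_prod:
  assumes "dim_vec z = dim_vec v"
  shows "(\<Sum>k\<in>support z. v $ k) = z \<bullet> v"
  unfolding scalar_prod_def support_def
  by (rule sum.mono_neutral_cong_left) (use assms in auto)

lemma parity_flip:
  assumes "\<And>k. k \<in> A \<Longrightarrow> (bit r k \<noteq> bit c k) = (v $ k = 1)"
  shows "parity A r = parity A c + (\<Sum>k\<in>A. v $ k)"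
proof -
  have "of_bool (bit r k) = of_bool (bit c k) + v $ k" if "k \<in> A" for k
    using assms[OF that] by (cases "v $ k") auto
  then show ?thesis
    unfolding parity_def sum.distrib[symmetric] by (intro sum.cong) auto
qed

text \<open>At a nonzero entry of \<open>pauli_X v\<close>, the row index is the column index with
  the support of \<open>v\<close> flipped, so the two parities differ by
  \<open>z \<bullet> v\<close>. If this is 0, the phases cancel. If it is 1, the factor is
  \<open>\<i>\<close> for even column parity and \<open>cnj \<i>\<close> = \<open>-\<i>\<close> for
  odd column parity, which is \<open>\<i>\<close> times the diagonal entry of
  \<open>pauli_Z z\<close> at that column.\<close>

lemma parity_phase_conj_pauli_X:
  assumes v: "dim_vec v = n" and z: "dim_vec z = n"
  shows "parity_phase_op n (support z) * pauli_X v * mat_adjoint (parity_phase_op n (support z)) =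
    (if z \<bullet> v = 1 then \<i> \<cdot>\<^sub>m (pauli_X v * pauli_Z z) else pauli_X v)" (is "?L = ?R")
proof (rule eq_matI)
  have X: "pauli_X v \<in> carrier_mat (2 ^ n) (2 ^ n)" and Z: "pauli_Z z \<in> carrier_mat (2 ^ n) (2 ^ n)"
    using pauli_carrier(1)[of v] pauli_carrier(2)[of z] v z by auto
  have R: "?R \<in> carrier_mat (2 ^ n) (2 ^ n)"
    using X Z by simp
  have L: "?L \<in> carrier_mat (2 ^ n) (2 ^ n)"
    unfolding parity_phase_op_def by (rule mat_diag_conj_carrier[OF X])
  show "dim_row ?L = dim_row ?R" "dim_col ?L = dim_col ?R"
    using L R by auto
  fix r c
  assume "r < dim_row ?R" "c < dim_col ?R"
  then have rc: "r < 2 ^ n" "c < 2 ^ n"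
    using R by auto
  have R_index: "?R $$ (r, c) =
      (if z \<bullet> v = 1 then \<i> * (if parity (support z) c = 1 then -1 else 1) else 1) * pauli_X v $$ (r, c)"
    using X rc v z by (auto simp: pauli_Z_eq_mat_diag mat_diag_mult_right)
  show "?L $$ (r, c) = ?R $$ (r, c)"
  proof (cases "\<forall>k<n. (bit r k \<noteq> bit c k) = (v $ k = 1)")
    case True
    then have "parity (support z) r = parity (support z) c + (\<Sum>k\<in>support z. v $ k)"
      by (intro parity_flip) (auto simp: support_def z)
    then have par: "parity (support z) r = parity (support z) c + z \<bullet> v"
      using sum_support_eq_scalar_prod[of z v] v z by simp
    show ?thesis
      unfolding R_index unfolding parity_phase_op_def mat_diag_conj_index[OF X rc] par
      by (cases "z \<bullet> v"; cases "parity (support z) c") auto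
  next
    case False
    then have "pauli_X v $$ (r, c) = 0"
      using pauli_X_index[of r v c] rc v by auto
    then show ?thesis
      unfolding R_index unfolding parity_phase_op_def mat_diag_conj_index[OF X rc] by simp
  qed
qed


section \<open>A CNOT ladder for the parity-controlled phase\<close>

text \<open>The recursion wraps the circuit in a matching pair of CNOTs instead of appending two
  separate ladders, so one induction step is one conjugation by a CNOT. The qubit \<open>q\<close>
  is the target of all of them.\<close>

fun parity_phase_circuit :: "nat \<Rightarrow> nat list \<Rightarrow> gate list" where
  "parity_phase_circuit q [] = [Phase q]"
| "parity_phase_circuit q (p # ps) = CNOT p q # parity_phase_circuit q ps @ [CNOT p q]"

section \<open>Composition of circuits\<close>

lemma gate_op_carrier [simp]: "gate_op n g \<in> carrier_mat (2 ^ n) (2 ^ n)"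
  by (cases g) (simp_all add: one_qubit_op_def two_qubit_op_def)

lemma dim_gate_op [simp]: "dim_row (gate_op n g) = 2 ^ n" "dim_col (gate_op n g) = 2 ^ n"
  using gate_op_carrier[of n g] by blast+

lemma circuit_unitary_carrier [simp]: "circuit_unitary n C \<in> carrier_mat (2 ^ n) (2 ^ n)"
  by (induction C) (auto intro!: mult_carrier_mat[of _ "2 ^ n" "2 ^ n"])

lemma circuit_unitary_append:
  "circuit_unitary n (C @ D) = circuit_unitary n D * circuit_unitary n C"
proof (induction C)
  case Nil
  show ?case
    by (simp add: right_mult_one_mat[OF circuit_unitary_carrier])
next
  case (Cons g C)
  then show ?case
    by (simp add: assoc_mult_mat[of _ "2 ^ n" "2 ^ n" _ "2 ^ n" _ "2 ^ n"])
qed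

text \<open>The permutation of basis indices whose permutation matrix is the CNOT with control
  \<open>p\<close> and target \<open>q\<close>.\<close>

definition cnot_index :: "nat \<Rightarrow> nat \<Rightarrow> nat \<Rightarrow> nat" where
  "cnot_index p q c = (if bit c p then flip_bit q c else c)"

lemma bit_cnot_index: "bit (cnot_index p q c) k = (bit c k \<noteq> (k = q \<and> bit c p))"
  by (auto simp: cnot_index_def bit_flip_bit_iff)

lemma cnot_index_less:
  assumes "q < n" "c < 2 ^ n"
  shows "cnot_index p q c < 2 ^ n"
proof -
  have "take_bit n (cnot_index p q c) = cnot_index p q c"
    using assms by (simp add: cnot_index_def take_bit_flip_bit_eq take_bit_nat_eq_self)
  then show ?thesis
    by (metis take_bit_nat_less_exp)
qed

lemma cnot_index_involutive:
  assumes "p \<noteq> q"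
  shows "cnot_index p q (cnot_index p q c) = c"
  by (rule bit_eqI) (use assms in \<open>auto simp: bit_cnot_index\<close>)

text \<open>Both indices lie below \<open>2 ^ n\<close>, so they can be compared bit by bit: the
  nonzero entries of the gate keep bit \<open>p\<close>, add it to bit \<open>q\<close>, and leave
  the other bits alone.\<close>

lemma CNOT_index:
  assumes pq: "p < n" "q < n" "p \<noteq> q" and rc: "r < 2 ^ n" "c < 2 ^ n"
  shows "gate_op n (CNOT p q) $$ (r, c) = of_bool (r = cnot_index p q c)"
proof -
  have "(r = cnot_index p q c) \<longleftrightarrow> (\<forall>k<n. bit r k = (bit c k \<noteq> (k = q \<and> bit c p)))"
    using bits_eq_imp_eq[OF rc(1) cnot_index_less[OF pq(2) rc(2)], of p]
    by (auto simp: bit_cnot_index)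
  also have "\<dots> \<longleftrightarrow> (\<forall>k<n. k \<noteq> p \<and> k \<noteq> q \<longrightarrow> bit r k = bit c k) \<and>
      bit r p = bit c p \<and> bit r q = (bit c q \<noteq> bit c p)"
    using pq by auto
  finally show ?thesis
    using rc by (auto simp: two_qubit_op_def CNOT_mat_def mat_of_rows_list_def)
qed

text \<open>A CNOT is a self-inverse permutation matrix, so conjugating by it permutes the
  diagonal.\<close>

lemma CNOT_conj_mat_diag:
  assumes pq: "p < n" "q < n" "p \<noteq> q"
  shows "gate_op n (CNOT p q) * (mat_diag (2 ^ n) f * gate_op n (CNOT p q)) =
    mat_diag (2 ^ n) (\<lambda>c. f (cnot_index p q c))" (is "?G * (?D * ?G) = ?E")
proof (rule eq_matI)
  fix r c
  assume "r < dim_row ?E" "c < dim_col ?E"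
  then have rc: "r < 2 ^ n" "c < 2 ^ n"
    by (simp_all add: mat_diag_def)
  note c' = cnot_index_less[OF pq(2) rc(2), of p]
  have DG: "?D * ?G \<in> carrier_mat (2 ^ n) (2 ^ n)"
    by (intro mult_carrier_mat[of _ "2 ^ n" "2 ^ n"] mat_diag_dim gate_op_carrier)
  have "(?G * (?D * ?G)) $$ (r, c) = (\<Sum>k<2 ^ n. ?G $$ (r, k) * (?D * ?G) $$ (k, c))"
    using rc DG
    by (auto simp: scalar_prod_def lessThan_atLeast0 simp del: gate_op.simps intro!: sum.cong)
  also have "\<dots> = (\<Sum>k<2 ^ n. if k = cnot_index p q c
      then of_bool (r = cnot_index p q k) * f k else 0)"
    by (rule sum.cong)
      (use rc in \<open>auto simp: mat_diag_mult_left[OF gate_op_carrier] CNOT_index[OF pq] simp del: gate_op.simps\<close>)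
  \<comment> \<open>Only \<open>k = cnot_index p q c\<close> contributes, and applying the
    involution again returns \<open>c\<close>.\<close>
  also have "\<dots> = of_bool (r = c) * f (cnot_index p q c)"
    using c' by (simp add: cnot_index_involutive[OF pq(3)])
  finally show "(?G * (?D * ?G)) $$ (r, c) = ?E $$ (r, c)"
    using rc by (simp add: mat_diag_def)
qed (simp_all add: mat_diag_def del: gate_op.simps)

text \<open>The CNOT adds bit \<open>p\<close> to bit \<open>q\<close>, which the parity over
  \<open>A\<close> already counts; as \<open>p\<close> is not in \<open>A\<close>, the effect is
  that of counting \<open>p\<close> as well.\<close>

lemma parity_cnot_index:
  assumes "finite A" "q \<in> A" "p \<notin> A"
  shows "parity A (cnot_index p q c) = parity (insert p A) c"
proof -
  have "parity A (cnot_index p q c) =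
      (\<Sum>k\<in>A. of_bool (bit c k) + (if k = q then of_bool (bit c p) else 0))"
    unfolding parity_def by (rule sum.cong) (auto simp: bit_cnot_index)
  also have "\<dots> = parity A c + (\<Sum>k\<in>A. if k = q then of_bool (bit c p) else 0)"
    by (simp only: parity_def sum.distrib)
  also have "\<dots> = parity A c + of_bool (bit c p)"
    using assms by (subst sum.delta) simp_all
  also have "\<dots> = parity (insert p A) c"
    unfolding parity_def using assms by (subst sum.insert) (simp_all only: add.commute not_False_eq_True)
  finally show ?thesis .
qed

text \<open>Starting from the Phase gate on \<open>q\<close>, each enclosing pair of CNOTs adds its
  control to the set whose parity governs the phase.\<close>

lemma circuit_unitary_parity_phase_circuit:
  assumes "distinct (q # ps)" "set (q # ps) \<subseteq> {..<n}"
  shows "circuit_unitary n (parity_phase_circuit q ps) = parity_phase_op n (set (q # ps))"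
  using assms
proof (induction ps)
  case Nil
  have "one_qubit_op n S_mat q \<in> carrier_mat (2 ^ n) (2 ^ n)"
    by (simp add: one_qubit_op_def)
  then show ?case
    using Nil Phase_op_eq[of q n] by simp
next
  case (Cons p ps)
  then have pq: "p < n" "q < n" "p \<noteq> q" and p: "p \<notin> set (q # ps)"
    by auto
  let ?G = "gate_op n (CNOT p q)"
  have "circuit_unitary n (parity_phase_circuit q (p # ps)) =
      ?G * (circuit_unitary n (parity_phase_circuit q ps) * ?G)"
    by (simp add: circuit_unitary_append assoc_mult_mat[of _ "2 ^ n" "2 ^ n" _ "2 ^ n" _ "2 ^ n"]
        left_mult_one_mat[OF gate_op_carrier] del: gate_op.simps)
  also have "circuit_unitary n (parity_phase_circuit q ps) = parity_phase_op n (set (q # ps))"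
    using Cons by auto
  also have "?G * (parity_phase_op n (set (q # ps)) * ?G) = parity_phase_op n (insert p (set (q # ps)))"
    unfolding parity_phase_op_def CNOT_conj_mat_diag[OF pq]
    using parity_cnot_index[of "set (q # ps)" q p] p by simp
  finally show ?case
    by (simp add: insert_commute)
qed

section \<open>Validity, depth and support of the ladder\<close>

lemma clifford_circuit_parity_phase_circuit:
  assumes "distinct (q # ps)" "set (q # ps) \<subseteq> {..<n}"
  shows "clifford_circuit n (parity_phase_circuit q ps)"
  using assms by (induction ps) (auto simp: clifford_circuit_def)

text \<open>Any two gates overlap at \<open>q\<close>, so layer numbers increase strictly along the
  circuit and gate number \<open>j\<close> lies in layer \<open>j\<close> or later. No two gates can
  run in parallel.\<close>

lemma circuit_depth_common_qubit:
  assumes "\<And>g. g \<in> set C \<Longrightarrow> q \<in> gate_qubits g"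
  shows "circuit_depth C = length C"
proof (rule antisym)
  show "circuit_depth C \<le> length C"
    unfolding circuit_depth_def by (rule Least_le) (auto simp: layering_def intro!: exI[of _ "\<lambda>j. j"])
  obtain l where l: "layering C (circuit_depth C) l"
    using layering_circuit_depth by blast
  have step: "l k < l j" if "k < j" "j < length C" for j k
  proof -
    have "q \<in> gate_qubits (C ! k) \<inter> gate_qubits (C ! j)"
      using that assms by simp
    then show ?thesis
      using l that unfolding layering_def by blast
  qed
  have "j \<le> l j" if "j < length C" for j
    using that
  proof (induction j)
    case (Suc j)
    then show ?case
      using step[of j "Suc j"] by simp
  qed simp
  moreover have "l j < circuit_depth C" if "j < length C" for j
    using l that by (simp add: layering_def)
  ultimately show "length C \<le> circuit_depth C"
    by (metis Suc_leI less_le_trans not_less not_less_eq_eq order_refl)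
qed

lemma circuit_depth_parity_phase_circuit:
  "circuit_depth (parity_phase_circuit q ps) = 2 * length ps + 1"
proof -
  have "q \<in> gate_qubits g" if "g \<in> set (parity_phase_circuit q ps)" for g
    using that by (induction ps) auto
  then have "circuit_depth (parity_phase_circuit q ps) = length (parity_phase_circuit q ps)"
    by (rule circuit_depth_common_qubit)
  also have "\<dots> = 2 * length ps + 1"
    by (induction ps) auto
  finally show ?thesis .
qed

text \<open>If the operator is the identity on \<open>q\<close>, its diagonal entries at the
  all-zero state and at \<open>2 ^ q\<close>, where only qubit \<open>q\<close> is set, coincide;
  for \<open>q\<close> in \<open>A\<close> they would be 1 and \<open>\<i>\<close>. Conversely,
  parities over a set without \<open>q\<close> ignore bit \<open>q\<close>.\<close>

lemma acts_as_identity_on_parity_phase_op: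
  assumes "finite A" "q < n"
  shows "acts_as_identity_on n (parity_phase_op n A) q \<longleftrightarrow> q \<notin> A"
proof
  assume "acts_as_identity_on n (parity_phase_op n A) q"
  then obtain V where V: "\<And>r c. r < 2 ^ n \<Longrightarrow> c < 2 ^ n \<Longrightarrow> parity_phase_op n A $$ (r, c) =
      (if bit r q = bit c q then V (unset_bit q r) (unset_bit q c) else 0)"
    unfolding acts_as_identity_on_def by blast
  have less: "2 ^ q < (2 ^ n :: nat)"
    using assms by simp
  have "unset_bit q (2 ^ q :: nat) = 0"
    by (rule bit_eqI) (auto simp: bit_unset_bit_iff bit_exp_iff)
  then have "parity_phase_op n A $$ (2 ^ q, 2 ^ q) = parity_phase_op n A $$ (0, 0)"
    using V[OF less less] V[of 0 0] by simp
  moreover have "parity A 0 = 0"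
    by (simp add: parity_def)
  ultimately have "parity A (2 ^ q) \<noteq> 1"
    using less by (auto simp: parity_phase_op_def mat_diag_def split: if_splits)
  moreover have "parity A (2 ^ q) = (\<Sum>k\<in>A. if k = q then 1 else 0)"
    unfolding parity_def by (rule sum.cong) (auto simp: bit_exp_iff)
  ultimately show "q \<notin> A"
    using assms by auto
next
  assume q: "q \<notin> A"
  have par: "parity A (unset_bit q c) = parity A c" for c
    unfolding parity_def by (rule sum.cong) (use q in \<open>auto simp: bit_unset_bit_iff\<close>)
  have eqI: "r = c" if "bit r q = bit c q" "unset_bit q r = unset_bit q c" for r c :: nat
  proof (rule bit_eqI)
    fix k
    have "bit (unset_bit q r) k = bit (unset_bit q c) k"
      using that(2) by simp
    then show "bit r k = bit c k"
      using that(1) by (cases "k = q") (auto simp: bit_unset_bit_iff)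
  qed
  \<comment> \<open>The same diagonal operator, extended to all indices; clearing bit
    \<open>q\<close> does not change its phase.\<close>
  define V :: "nat \<Rightarrow> nat \<Rightarrow> complex"
    where "V r c = (if r = c then if parity A c = 1 then \<i> else 1 else 0)" for r c
  show "acts_as_identity_on n (parity_phase_op n A) q"
    unfolding acts_as_identity_on_def
  proof (intro exI[of _ V] allI impI)
    fix r c :: nat
    assume "r < 2 ^ n" "c < 2 ^ n"
    then show "parity_phase_op n A $$ (r, c) =
        (if bit r q = bit c q then V (unset_bit q r) (unset_bit q c) else 0)"
      using eqI[of r c] by (cases "r = c") (auto simp: parity_phase_op_def mat_diag_def V_def par)
  qed
qed

lemma support_size_parity_phase_circuit:
  assumes "distinct (q # ps)" "set (q # ps) \<subseteq> {..<n}"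
  shows "support_size n (parity_phase_circuit q ps) = length ps + 1"
proof -
  have "circuit_support n (parity_phase_circuit q ps) = set (q # ps)"
    unfolding circuit_support_eq circuit_unitary_parity_phase_circuit[OF assms]
    using assms(2) acts_as_identity_on_parity_phase_op[of "set (q # ps)" _ n] by auto
  then show ?thesis
    unfolding support_size_def using distinct_card[OF assms(1)] by simp
qed


section \<open>Kronecker products and the hypergraph product code\<close>

text \<open>The range splits into \<open>m\<close> blocks of \<open>n\<close> consecutive indices;
  the quotient is constant on a block while the remainder runs through all values below
  \<open>n\<close>.\<close>

lemma sum_div_mod:
  fixes f g :: "nat \<Rightarrow> 'a :: semiring_0"
  shows "(\<Sum>k<m * n. f (k div n) * g (k mod n)) = (\<Sum>i<m. f i) * (\<Sum>j<n. g j)"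
proof -
  have "(\<Sum>k<m * n. f (k div n) * g (k mod n)) =
      (\<Sum>i<m. \<Sum>k\<in>{i * n..<i * n + n}. f (k div n) * g (k mod n))"
    by (rule sum.nat_group[symmetric])
  also have "\<dots> = (\<Sum>i<m. \<Sum>j<n. f i * g j)"
  proof (rule sum.cong[OF refl])
    fix i
    have "(\<Sum>k\<in>{i * n..<i * n + n}. f (k div n) * g (k mod n)) =
        (\<Sum>j\<in>{0..<n}. f ((j + i * n) div n) * g ((j + i * n) mod n))"
      using sum.shift_bounds_nat_ivl[of "\<lambda>k. f (k div n) * g (k mod n)" 0 "i * n" n]
      by (simp add: add.commute)
    also have "\<dots> = (\<Sum>j<n. f i * g j)"
      by (rule sum.cong) auto
    finally show "(\<Sum>k\<in>{i * n..<i * n + n}. f (k div n) * g (k mod n)) = (\<Sum>j<n. f i * g j)" .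
  qed
  finally show ?thesis
    by (simp add: sum_product)
qed

lemma dim_kron_vec [simp]: "dim_vec (kron_vec u v) = dim_vec u * dim_vec v"
  by (simp add: kron_vec_def)

lemma dim_kron_mat [simp]:
  "dim_row (kron_mat A B) = dim_row A * dim_row B" "dim_col (kron_mat A B) = dim_col A * dim_col B"
  by (simp_all add: kron_mat_def)

text \<open>This splits overlaps in the left sector into a factor for each constituent code.\<close>

lemma scalar_prod_kron_vec:
  fixes u v u' v' :: "'a :: comm_semiring_0 vec"
  assumes "dim_vec u = dim_vec u'" "dim_vec v = dim_vec v'"
  shows "kron_vec u v \<bullet> kron_vec u' v' = (u \<bullet> u') * (v \<bullet> v')"
proof -
  have "kron_vec u v \<bullet> kron_vec u' v' = (\<Sum>k<dim_vec u' * dim_vec v'.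
      (u $ (k div dim_vec v') * u' $ (k div dim_vec v')) * (v $ (k mod dim_vec v') * v' $ (k mod dim_vec v')))"
    unfolding scalar_prod_def lessThan_atLeast0
    by (rule sum.cong) (auto simp: kron_vec_def assms ac_simps)
  then show ?thesis
    using sum_div_mod[of "\<lambda>i. u $ i * u' $ i" "dim_vec v'" "\<lambda>j. v $ j * v' $ j" "dim_vec u'"]
    by (simp add: scalar_prod_def lessThan_atLeast0)
qed

lemma div_mod_less:
  fixes k :: nat
  assumes "k < m * n"
  shows "k div n < m" "k mod n < n"
proof -
  have "0 < n"
    using assms by (cases n) auto
  then show "k div n < m" "k mod n < n"
    using assms by (simp_all add: less_mult_imp_div_less)
qed

lemma row_kron_mat:
  assumes "r < dim_row A * dim_row B"
  shows "row (kron_mat A B) r = kron_vec (row A (r div dim_row B)) (row B (r mod dim_row B))"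
proof (rule eq_vecI)
  note r = div_mod_less[OF assms]
  fix k
  assume "k < dim_vec (kron_vec (row A (r div dim_row B)) (row B (r mod dim_row B)))"
  then have k: "k < dim_col A * dim_col B"
    by simp
  then show "row (kron_mat A B) r $ k =
      kron_vec (row A (r div dim_row B)) (row B (r mod dim_row B)) $ k"
    using r k assms div_mod_less[OF k] by (simp add: kron_mat_def kron_vec_def)
qed (simp add: kron_mat_def)

lemma row_append_cols:
  assumes "dim_row A = dim_row B" "r < dim_row A"
  shows "row (append_cols A B) r = row A r @\<^sub>v row B r"
  unfolding append_cols_def
  by (rule eq_vecI) (use assms in \<open>auto simp: append_vec_def Let_def\<close>)

text \<open>The nonzero entries sit exactly at the positions \<open>k * n + h\<close> with
  \<open>u $ k\<close> nonzero.\<close>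

lemma hamming_weight_kron_unit_vec:
  assumes "h < n"
  shows "hamming_weight (kron_vec u (unit_vec n h)) = hamming_weight u"
proof -
  have "bij_betw (\<lambda>k. k * n + h) {k. k < dim_vec u \<and> u $ k \<noteq> 0}
      {k. k < dim_vec (kron_vec u (unit_vec n h)) \<and> kron_vec u (unit_vec n h) $ k \<noteq> 0}"
  proof (rule bij_betwI[where g = "\<lambda>k. k div n"])
    show "(\<lambda>k. k * n + h) \<in> {k. k < dim_vec u \<and> u $ k \<noteq> 0} \<rightarrow>
      {k. k < dim_vec (kron_vec u (unit_vec n h)) \<and> kron_vec u (unit_vec n h) $ k \<noteq> 0}"
    proof
      fix k
      assume k: "k \<in> {k. k < dim_vec u \<and> u $ k \<noteq> 0}"
      have "k * n + h < Suc k * n"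
        using assms by simp
      also have "\<dots> \<le> dim_vec u * n"
        using k by (intro mult_right_mono) auto
      finally show "k * n + h \<in>
          {k. k < dim_vec (kron_vec u (unit_vec n h)) \<and> kron_vec u (unit_vec n h) $ k \<noteq> 0}"
        using k assms by (simp add: kron_vec_def)
    qed
    show "(\<lambda>k. k div n) \<in> {k. k < dim_vec (kron_vec u (unit_vec n h)) \<and>
        kron_vec u (unit_vec n h) $ k \<noteq> 0} \<rightarrow> {k. k < dim_vec u \<and> u $ k \<noteq> 0}"
      by (auto simp: kron_vec_def less_mult_imp_div_less)
    show "(k * n + h) div n = k" for k
      using assms by simp
    fix k
    assume "k \<in> {k. k < dim_vec (kron_vec u (unit_vec n h)) \<and> kron_vec u (unit_vec n h) $ k \<noteq> 0}"
    then have "k mod n = h"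
      using assms by (auto simp: kron_vec_def unit_vec_def split: if_splits)
    then show "k div n * n + h = k"
      by (metis div_mult_mod_eq)
  qed
  then show ?thesis
    unfolding hamming_weight_def by (rule bij_betw_same_card[symmetric])
qed

lemma hamming_weight_left_vec: "hamming_weight (left_vec Q u) = hamming_weight u"
  unfolding hamming_weight_def left_vec_def
  by (rule arg_cong[of _ _ card]) (auto split: if_splits)

section \<open>SLT bases and support vectors of logical Paulis\<close>

lemma slt_basisD:
  assumes "slt_basis H a" "i \<in> dom a"
  shows "i < dim_col H" "the (a i) \<in> mat_kernel H" "the (a i) $ i = 1"
    "\<And>i'. i' \<in> dom a \<Longrightarrow> i' \<noteq> i \<Longrightarrow> the (a i) $ i' = 0"
proof -
  interpret kernel "dim_row H" "dim_col H" H
    by unfold_locales auto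
  have "ran a \<subseteq> mat_kernel H"
    using assms(1) unfolding slt_basis_def Ker.basis_def by auto
  then show "the (a i) \<in> mat_kernel H"
    using assms(2) by (auto simp: ran_def)
qed (use assms in \<open>auto simp: slt_basis_def\<close>)

lemma dim_vec_mat_kernel: "v \<in> mat_kernel H \<Longrightarrow> dim_vec v = dim_col H"
  by (simp add: mat_kernel_def)

text \<open>The vectors behind \<open>logical_op\<close>, separated from the operators so that
  commutation questions reduce to binary inner products.\<close>

fun logical_vec :: "hgp_code \<Rightarrow> logical_pauli \<Rightarrow> bit vec" where
  "logical_vec Q (LogicalX (LeftSector i' h')) =
     left_vec Q (kron_vec (unit_vec (len_a Q) i') (the (slt_b Q h')))"
| "logical_vec Q (LogicalZ (LeftSector i' h')) =
     left_vec Q (kron_vec (the (slt_a Q i')) (unit_vec (len_b Q) h'))"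
| "logical_vec Q (LogicalX (RightSector j l)) =
     right_vec Q (kron_vec (the (slt_aT Q j)) (unit_vec (checks_b Q) l))"
| "logical_vec Q (LogicalZ (RightSector j l)) =
     right_vec Q (kron_vec (unit_vec (checks_a Q) j) (the (slt_bT Q l)))"

lemma logical_op_eq:
  "logical_op Q (LogicalX k) = pauli_X (logical_vec Q (LogicalX k))"
  "logical_op Q (LogicalZ k) = pauli_Z (logical_vec Q (LogicalZ k))"
  by (cases k; simp)+

section \<open>The circuit for a fixed logical qubit of the left sector\<close>

context
  fixes Q :: hgp_code and i h :: nat
  assumes bases: "has_slt_bases Q" and i: "i \<in> dom (slt_a Q)" and h: "h \<in> dom (slt_b Q)"
begin

definition targeted_Z_vec :: "bit vec" where
  "targeted_Z_vec = left_vec Q (kron_vec (the (slt_a Q i)) (unit_vec (len_b Q) h))"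

text \<open>The physical qubit at the pair of pivots \<open>(i, h)\<close>, in the row-major order
  of \<open>kron_vec\<close>.\<close>

definition targeted_pivot :: nat where
  "targeted_pivot = i * len_b Q + h"

definition targeted_phase_circuit :: "gate list" where
  "targeted_phase_circuit = parity_phase_circuit targeted_pivot
     (sorted_list_of_set (support targeted_Z_vec - {targeted_pivot}))"

lemma slt_facts:
  "i < len_a Q" "h < len_b Q" "the (slt_a Q i) \<in> mat_kernel (check_a Q)"
  "dim_vec (the (slt_a Q i)) = len_a Q" "the (slt_a Q i) $ i = 1"
  using bases slt_basisD(1-3)[OF _ i, of "check_a Q"] slt_basisD(1)[OF _ h, of "check_b Q"]
    slt_basisD(2)[OF _ i, of "check_a Q", THEN dim_vec_mat_kernel]
  unfolding has_slt_bases_def by blast+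

lemma dim_targeted_Z_vec: "dim_vec targeted_Z_vec = num_qubits Q"
  by (simp add: targeted_Z_vec_def left_vec_def num_qubits_def slt_facts)

lemma targeted_pivot_in_support: "targeted_pivot \<in> support targeted_Z_vec"
proof -
  have "i * len_b Q + h < Suc i * len_b Q"
    using slt_facts by simp
  also have "\<dots> \<le> len_a Q * len_b Q"
    using slt_facts by (intro mult_right_mono) auto
  finally show ?thesis
    using slt_facts
    by (simp add: support_def targeted_Z_vec_def targeted_pivot_def left_vec_def kron_vec_def)
qed

text \<open>The targeted \<open>Z\<close> vanishes on the right sector, so only the left part of the
  other vector matters.\<close>

lemma scalar_prod_targeted_Z_vec:
  assumes "dim_vec u = len_a Q * len_b Q" "dim_vec w = checks_a Q * checks_b Q"
  shows "targeted_Z_vec \<bullet> (u @\<^sub>v w) = kron_vec (the (slt_a Q i)) (unit_vec (len_b Q) h) \<bullet> u"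
proof -
  have k: "kron_vec (the (slt_a Q i)) (unit_vec (len_b Q) h) \<in> carrier_vec (len_a Q * len_b Q)"
    by (rule carrier_vecI) (simp only: dim_kron_vec index_unit_vec slt_facts(4))
  have w: "w \<in> carrier_vec (checks_a Q * checks_b Q)"
    using assms(2) by (rule carrier_vecI)
  show ?thesis
    unfolding targeted_Z_vec_def left_vec_def
      scalar_prod_append[OF k zero_carrier_vec carrier_vecI[OF assms(1)] w]
      scalar_prod_left_zero[OF w] add_0_right ..
qed

text \<open>On the left sector a row of \<open>hgp_HX Q\<close> is a row of \<open>check_a Q\<close>
  tensored with a unit vector, and the first factor is orthogonal to \<open>the (slt_a Q i)\<close>,
  a kernel vector.\<close>

lemma targeted_Z_vec_orthogonal_HX:
  assumes r: "r < dim_row (hgp_HX Q)"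
  shows "targeted_Z_vec \<bullet> row (hgp_HX Q) r = 0" "dim_vec (row (hgp_HX Q) r) = num_qubits Q"
proof -
  have r: "r < checks_a Q * len_b Q"
    using r by (simp add: hgp_HX_def append_cols_def kron_mat_def)
  then have r': "r div len_b Q < checks_a Q"
    by (simp add: less_mult_imp_div_less)
  let ?B = "row (kron_mat (1\<^sub>m (checks_a Q)) (transpose_mat (check_b Q))) r"
  have row: "row (hgp_HX Q) r =
      kron_vec (row (check_a Q) (r div len_b Q)) (row (1\<^sub>m (len_b Q)) (r mod len_b Q)) @\<^sub>v ?B"
  proof -
    have "row (hgp_HX Q) r = row (kron_mat (check_a Q) (1\<^sub>m (len_b Q))) r @\<^sub>v ?B"
      unfolding hgp_HX_def by (rule row_append_cols) (use r in simp_all)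
    then show ?thesis
      using row_kron_mat[of r "check_a Q" "1\<^sub>m (len_b Q)"] r by simp
  qed
  show "dim_vec (row (hgp_HX Q) r) = num_qubits Q"
    unfolding row by (simp add: num_qubits_def)
  have "the (slt_a Q i) \<bullet> row (check_a Q) (r div len_b Q) =
      row (check_a Q) (r div len_b Q) \<bullet> the (slt_a Q i)"
    by (intro comm_scalar_prod[of _ "len_a Q"] carrier_vecI) (simp_all add: slt_facts(4))
  also have "\<dots> = (check_a Q *\<^sub>v the (slt_a Q i)) $ (r div len_b Q)"
    using r' by simp
  also have "\<dots> = 0"
    using slt_facts(3) r' by (simp add: mat_kernel_def)
  finally have orth: "the (slt_a Q i) \<bullet> row (check_a Q) (r div len_b Q) = 0" .
  have "targeted_Z_vec \<bullet> row (hgp_HX Q) r = kron_vec (the (slt_a Q i)) (unit_vec (len_b Q) h) \<bullet>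
      kron_vec (row (check_a Q) (r div len_b Q)) (row (1\<^sub>m (len_b Q)) (r mod len_b Q))"
    unfolding row by (rule scalar_prod_targeted_Z_vec) simp_all
  also have "\<dots> = (the (slt_a Q i) \<bullet> row (check_a Q) (r div len_b Q)) *
      (unit_vec (len_b Q) h \<bullet> row (1\<^sub>m (len_b Q)) (r mod len_b Q))"
    by (rule scalar_prod_kron_vec) (simp_all add: slt_facts(4))
  finally show "targeted_Z_vec \<bullet> row (hgp_HX Q) r = 0"
    unfolding orth mult_zero_left .
qed

lemma dim_row_hgp_HZ: "dim_vec (row (hgp_HZ Q) r) = num_qubits Q"
  by (simp add: hgp_HZ_def append_cols_def kron_mat_def num_qubits_def)

lemma dim_slt:
  "i' \<in> dom (slt_a Q) \<Longrightarrow> dim_vec (the (slt_a Q i')) = len_a Q"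
  "j \<in> dom (slt_aT Q) \<Longrightarrow> dim_vec (the (slt_aT Q j)) = checks_a Q"
  "h' \<in> dom (slt_b Q) \<Longrightarrow> dim_vec (the (slt_b Q h')) = len_b Q"
  "l \<in> dom (slt_bT Q) \<Longrightarrow> dim_vec (the (slt_bT Q l)) = checks_b Q"
  using bases slt_basisD(2)[THEN dim_vec_mat_kernel] unfolding has_slt_bases_def
  by (metis, metis index_transpose_mat(3), metis, metis index_transpose_mat(3))

lemma dim_logical_vec:
  assumes "k \<in> logical_qubits Q"
  shows "dim_vec (logical_vec Q (LogicalX k)) = num_qubits Q"
    "dim_vec (logical_vec Q (LogicalZ k)) = num_qubits Q"
  using assms unfolding logical_qubits_def
  by (elim UnE CollectE exE conjE; simp add: dim_slt left_vec_def right_vec_def num_qubits_def)+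

text \<open>In the left sector the product is entry \<open>i'\<close> of the basis vector at
  \<open>i\<close> times entry \<open>h\<close> of the basis vector at \<open>h'\<close>; all four
  are pivots, so the SLT conditions make both entries Kronecker deltas. Right-sector operators have
  disjoint support.\<close>

lemma targeted_Z_vec_logical_X:
  assumes "k \<in> logical_qubits Q"
  shows "targeted_Z_vec \<bullet> logical_vec Q (LogicalX k) = of_bool (k = LeftSector i h)"
proof (cases k)
  case (LeftSector i' h')
  then have ih': "i' \<in> dom (slt_a Q)" "h' \<in> dom (slt_b Q)"
    using assms by (auto simp: logical_qubits_def)
  have a: "slt_basis (check_a Q) (slt_a Q)" and b: "slt_basis (check_b Q) (slt_b Q)"
    using bases by (auto simp: has_slt_bases_def)
  have "targeted_Z_vec \<bullet> logical_vec Q (LogicalX k) =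
      (the (slt_a Q i) \<bullet> unit_vec (len_a Q) i') * (unit_vec (len_b Q) h \<bullet> the (slt_b Q h'))"
  proof -
    have "targeted_Z_vec \<bullet> logical_vec Q (LogicalX k) =
        kron_vec (the (slt_a Q i)) (unit_vec (len_b Q) h) \<bullet> kron_vec (unit_vec (len_a Q) i') (the (slt_b Q h'))"
      unfolding LeftSector logical_vec.simps left_vec_def
      by (rule scalar_prod_targeted_Z_vec) (simp_all add: dim_slt(3)[OF ih'(2)])
    also have "\<dots> = (the (slt_a Q i) \<bullet> unit_vec (len_a Q) i') * (unit_vec (len_b Q) h \<bullet> the (slt_b Q h'))"
      by (rule scalar_prod_kron_vec) (simp_all add: dim_slt(3)[OF ih'(2)] slt_facts(4))
    finally show ?thesis .
  qed
  also have "\<dots> = the (slt_a Q i) $ i' * the (slt_b Q h') $ h"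
    using scalar_prod_right_unit[OF slt_basisD(1)[OF a ih'(1)], of "the (slt_a Q i)"]
      scalar_prod_left_unit[OF carrier_vecI[OF dim_slt(3)[OF ih'(2)]] slt_facts(2)]
    by (simp only:)
  also have "\<dots> = of_bool (i' = i) * of_bool (h' = h)"
    using slt_basisD(3)[OF a i] slt_basisD(4)[OF a i ih'(1)] slt_basisD(3)[OF b ih'(2)]
      slt_basisD(4)[OF b ih'(2) h]
    by (cases "i' = i"; cases "h' = h") simp_all
  finally show ?thesis
    using LeftSector by auto
next
  case (RightSector j l)
  then have j: "j \<in> dom (slt_aT Q)"
    using assms by (auto simp: logical_qubits_def)
  have "targeted_Z_vec \<bullet> logical_vec Q (LogicalX k) =
      kron_vec (the (slt_a Q i)) (unit_vec (len_b Q) h) \<bullet> 0\<^sub>v (len_a Q * len_b Q)"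
    unfolding RightSector logical_vec.simps right_vec_def
    by (rule scalar_prod_targeted_Z_vec) (simp_all add: dim_slt(2)[OF j])
  also have "\<dots> = 0"
    by (intro scalar_prod_right_zero carrier_vecI) (simp only: dim_kron_vec index_unit_vec slt_facts(4))
  finally show ?thesis
    using RightSector by simp
qed

lemma targeted_circuit_qubits:
  defines "ps \<equiv> sorted_list_of_set (support targeted_Z_vec - {targeted_pivot})"
  shows "distinct (targeted_pivot # ps)" "set (targeted_pivot # ps) = support targeted_Z_vec"
    "set (targeted_pivot # ps) \<subseteq> {..<num_qubits Q}"
    "length ps + 1 = hamming_weight (the (slt_a Q i))"
proof -
  show d: "distinct (targeted_pivot # ps)" and s: "set (targeted_pivot # ps) = support targeted_Z_vec"
    using targeted_pivot_in_support by (auto simp: ps_def)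
  then show "set (targeted_pivot # ps) \<subseteq> {..<num_qubits Q}"
    using support_less[of _ targeted_Z_vec] by (auto simp: dim_targeted_Z_vec)
  have "length ps + 1 = hamming_weight targeted_Z_vec"
    using distinct_card[OF d] s by (simp add: card_support)
  then show "length ps + 1 = hamming_weight (the (slt_a Q i))"
    by (simp add: targeted_Z_vec_def hamming_weight_left_vec hamming_weight_kron_unit_vec slt_facts)
qed

lemma targeted_phase_circuit_clifford: "clifford_circuit (num_qubits Q) targeted_phase_circuit"
  unfolding targeted_phase_circuit_def
  by (rule clifford_circuit_parity_phase_circuit targeted_circuit_qubits)+

lemma targeted_phase_circuit_support_size:
  "support_size (num_qubits Q) targeted_phase_circuit = hamming_weight (the (slt_a Q i))"
  unfolding targeted_phase_circuit_def
  using support_size_parity_phase_circuit[OF targeted_circuit_qubits(1,3)] targeted_circuit_qubits(4)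
  by simp

lemma targeted_phase_circuit_depth:
  "circuit_depth targeted_phase_circuit + 1 = 2 * hamming_weight (the (slt_a Q i))"
  unfolding targeted_phase_circuit_def circuit_depth_parity_phase_circuit
  using targeted_circuit_qubits(4) by linarith

text \<open>By orthogonality, the stabilizer generators are fixed without any phase. By duality, the
  targeted logical \<open>X\<close> is the only logical Pauli that changes.\<close>

lemma targeted_phase_circuit_implements:
  "implements_logical_gate Q targeted_phase_circuit (logical_phase_gate (LeftSector i h))"
proof -
  define n where "n = num_qubits Q"
  have dz: "dim_vec targeted_Z_vec = n"
    by (simp add: n_def dim_targeted_Z_vec)
  have U: "circuit_unitary n targeted_phase_circuit = parity_phase_op n (support targeted_Z_vec)"
    using circuit_unitary_parity_phase_circuit[OF targeted_circuit_qubits(1,3)]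
    by (simp only: targeted_phase_circuit_def targeted_circuit_qubits(2) n_def)
  let ?U = "parity_phase_op n (support targeted_Z_vec)"
  have stab: "?U * S * mat_adjoint ?U = S" if "S \<in> stabilizer_generators Q" for S
    using that unfolding stabilizer_generators_def
  proof
    assume "S \<in> {pauli_X (row (hgp_HX Q) r) | r. r < dim_row (hgp_HX Q)}"
    then obtain r where "r < dim_row (hgp_HX Q)" "S = pauli_X (row (hgp_HX Q) r)"
      by blast
    then show ?thesis
      using targeted_Z_vec_orthogonal_HX[of r] dz
      by (simp add: parity_phase_conj_pauli_X n_def)
  next
    assume "S \<in> {pauli_Z (row (hgp_HZ Q) r) | r. r < dim_row (hgp_HZ Q)}"
    then obtain r where "S = pauli_Z (row (hgp_HZ Q) r)"
      by blast
    then show ?thesis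
      using dim_row_hgp_HZ[of r] by (simp add: parity_phase_conj_pauli_Z n_def)
  qed
  have target: "targeted_Z_vec = logical_vec Q (LogicalZ (LeftSector i h))"
    by (simp add: targeted_Z_vec_def)
  have logical: "\<exists>w. cmod w = 1 \<and> ?U * logical_op Q P * mat_adjoint ?U =
      w \<cdot>\<^sub>m logical_product Q (logical_phase_gate (LeftSector i h) P)" if P_in: "P \<in> logical_paulis Q" for P
  proof -
    have single: "1 \<cdot>\<^sub>m logical_product Q [P] = logical_op Q P" if "logical_op Q P \<in> carrier_mat (2 ^ n) (2 ^ n)"
    proof -
      have "logical_product Q [P] = logical_op Q P"
        using that by (simp add: logical_product_def n_def)
      then show ?thesis
        by (intro eq_matI) simp_all
    qed
    obtain k where k: "k \<in> logical_qubits Q" and P: "P = LogicalX k \<or> P = LogicalZ k"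
      using P_in by (auto simp: logical_paulis_def)
    note dims = dim_logical_vec[OF k, folded n_def]
    note X = pauli_carrier(1)[of "logical_vec Q (LogicalX k)", unfolded dims]
    note Z = pauli_carrier(2)[of "logical_vec Q (LogicalZ k)", unfolded dims]
    show ?thesis
    proof (cases "P = LogicalX (LeftSector i h)")
      case True
      with P have k_eq: "k = LeftSector i h"
        by auto
      have "?U * logical_op Q P * mat_adjoint ?U = \<i> \<cdot>\<^sub>m (logical_op Q P * pauli_Z targeted_Z_vec)"
        using parity_phase_conj_pauli_X[OF dims(1) dz] targeted_Z_vec_logical_X[OF k] True k_eq
        by (simp add: logical_op_eq del: logical_vec.simps logical_op.simps)
      also have "logical_op Q P * pauli_Z targeted_Z_vec =
          logical_product Q (logical_phase_gate (LeftSector i h) P)"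
        using Z True unfolding target k_eq n_def
        by (simp add: logical_product_def logical_phase_gate_def logical_op_eq
            del: logical_vec.simps logical_op.simps)
      finally show ?thesis
        \<comment> \<open>The phase \<open>\<i>\<close> comes from the odd-overlap case of the
          conjugation rule.\<close>
        by (intro exI[of _ \<i>]) simp
    next
      case False
      from P have "?U * logical_op Q P * mat_adjoint ?U = logical_op Q P"
      proof
        assume P: "P = LogicalX k"
        then show ?thesis
          using parity_phase_conj_pauli_X[OF dims(1) dz] targeted_Z_vec_logical_X[OF k] False
          by (simp add: logical_op_eq del: logical_vec.simps logical_op.simps)
      next
        assume P: "P = LogicalZ k"
        then show ?thesis
          using parity_phase_conj_pauli_Z[OF dims(2)]
          by (simp add: logical_op_eq del: logical_vec.simps logical_op.simps)
      qed
      moreover have "logical_op Q P \<in> carrier_mat (2 ^ n) (2 ^ n)"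
        using P X Z by (auto simp: logical_op_eq simp del: logical_vec.simps logical_op.simps)
      ultimately show ?thesis
        using single False by (intro exI[of _ 1]) (simp add: logical_phase_gate_def)
    qed
  qed
  show ?thesis
    unfolding implements_logical_gate_def Let_def n_def[symmetric] U
    using stab logical by blast
qed

end

section \<open>Uniform asymptotic bounds\<close>

text \<open>This carries the bounds on basis vector weights over to circuits, with \<open>p\<close>
  sending a logical qubit to its basis vector. The factor 2 accommodates the depth.\<close>

lemma uniformly_bigtheta_comparable:
  assumes bigtheta: "uniformly_bigtheta K f g"
    and p: "\<And>t l. l \<in> L t \<Longrightarrow> p t l \<in> K t"
    and lower: "\<And>t l. l \<in> L t \<Longrightarrow> f t (p t l) \<le> f' t l"
    and upper: "\<And>t l. l \<in> L t \<Longrightarrow> f' t l \<le> 2 * f t (p t l)"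
  shows "uniformly_bigtheta L f' g"
proof -
  obtain c d where "c > 0" "d > 0"
    and ev: "\<forall>\<^sub>F t in sequentially. \<forall>k \<in> K t. c * \<bar>g t\<bar> \<le> real (f t k) \<and> real (f t k) \<le> d * \<bar>g t\<bar>"
    using bigtheta unfolding uniformly_bigtheta_def by blast
  have "\<forall>\<^sub>F t in sequentially. \<forall>l \<in> L t. c * \<bar>g t\<bar> \<le> real (f' t l) \<and> real (f' t l) \<le> (2 * d) * \<bar>g t\<bar>"
    using ev
  proof eventually_elim
    case (elim t)
    show ?case
    proof
      fix l
      assume l: "l \<in> L t"
      have "real (f t (p t l)) \<le> real (f' t l)" "real (f' t l) \<le> 2 * real (f t (p t l))"
        using lower[OF l] upper[OF l] by linarith+
      moreover have "c * \<bar>g t\<bar> \<le> real (f t (p t l)) \<and> real (f t (p t l)) \<le> d * \<bar>g t\<bar>"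
        using elim p[OF l] by blast
      ultimately show "c * \<bar>g t\<bar> \<le> real (f' t l) \<and> real (f' t l) \<le> (2 * d) * \<bar>g t\<bar>"
        by linarith
    qed
  qed
  moreover have "2 * d > 0"
    using \<open>d > 0\<close> by simp
  ultimately show ?thesis
    unfolding uniformly_bigtheta_def using \<open>c > 0\<close> by blast
qed

theorem theorem4p4:
  fixes Q :: "nat \<Rightarrow> hgp_code"
  assumes bases: "\<And>t. has_slt_bases (Q t)"
    and scaling: "scaling_assumptions Q"
  shows "\<exists>C :: nat \<Rightarrow> nat \<times> nat \<Rightarrow> gate list.
    (\<forall>t. \<forall>i \<in> dom (slt_a (Q t)). \<forall>h \<in> dom (slt_b (Q t)).
       clifford_circuit (num_qubits (Q t)) (C t (i, h)) \<and>
       implements_logical_gate (Q t) (C t (i, h)) (logical_phase_gate (LeftSector i h))) \<and>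
    uniformly_bigtheta (\<lambda>t. dom (slt_a (Q t)) \<times> dom (slt_b (Q t)))
      (\<lambda>t ih. support_size (num_qubits (Q t)) (C t ih)) (\<lambda>t. sqrt (real (num_qubits (Q t)))) \<and>
    uniformly_bigtheta (\<lambda>t. dom (slt_a (Q t)) \<times> dom (slt_b (Q t)))
      (\<lambda>t ih. circuit_depth (C t ih)) (\<lambda>t. sqrt (real (num_qubits (Q t))))"
proof -
  define C where "C t ih = targeted_phase_circuit (Q t) (fst ih) (snd ih)" for t and ih :: "nat \<times> nat"
  define w where "w t ih = hamming_weight (the (slt_a (Q t) (fst ih)))" for t and ih :: "nat \<times> nat"
  have size: "support_size (num_qubits (Q t)) (C t ih) = w t ih"
    and depth: "circuit_depth (C t ih) + 1 = 2 * w t ih"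
    and range: "the (slt_a (Q t) (fst ih)) \<in> ran (slt_a (Q t))"
    if "ih \<in> dom (slt_a (Q t)) \<times> dom (slt_b (Q t))" for t ih
  proof -
    have ih: "fst ih \<in> dom (slt_a (Q t))" "snd ih \<in> dom (slt_b (Q t))"
      using that by auto
    show "support_size (num_qubits (Q t)) (C t ih) = w t ih"
      unfolding C_def w_def by (rule targeted_phase_circuit_support_size[OF bases ih])
    show "circuit_depth (C t ih) + 1 = 2 * w t ih"
      unfolding C_def w_def by (rule targeted_phase_circuit_depth[OF bases ih])
    show "the (slt_a (Q t) (fst ih)) \<in> ran (slt_a (Q t))"
      using ih(1) by (auto simp: ran_def)
  qed
  have weights: "uniformly_bigtheta (\<lambda>t. ran (slt_a (Q t))) (\<lambda>t. hamming_weight)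
      (\<lambda>t. sqrt (real (num_qubits (Q t))))"
    using scaling unfolding scaling_assumptions_def Let_def by blast
  have "uniformly_bigtheta (\<lambda>t. dom (slt_a (Q t)) \<times> dom (slt_b (Q t)))
      (\<lambda>t ih. support_size (num_qubits (Q t)) (C t ih)) (\<lambda>t. sqrt (real (num_qubits (Q t))))"
  proof (rule uniformly_bigtheta_comparable[OF weights range])
    fix t ih
    assume "ih \<in> dom (slt_a (Q t)) \<times> dom (slt_b (Q t))"
    note size[OF this, unfolded w_def]
    then show "hamming_weight (the (slt_a (Q t) (fst ih))) \<le> support_size (num_qubits (Q t)) (C t ih)"
      "support_size (num_qubits (Q t)) (C t ih) \<le> 2 * hamming_weight (the (slt_a (Q t) (fst ih)))"
      by linarith+
  qed
  moreover have "uniformly_bigtheta (\<lambda>t. dom (slt_a (Q t)) \<times> dom (slt_b (Q t)))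
      (\<lambda>t ih. circuit_depth (C t ih)) (\<lambda>t. sqrt (real (num_qubits (Q t))))"
  proof (rule uniformly_bigtheta_comparable[OF weights range])
    fix t ih
    assume "ih \<in> dom (slt_a (Q t)) \<times> dom (slt_b (Q t))"
    \<comment> \<open>The depth is 2w - 1 for the weight w. As it is a natural number, w is at least
      1, and so w \<le> 2w - 1 \<le> 2w.\<close>
    note depth[OF this, unfolded w_def]
    then show "hamming_weight (the (slt_a (Q t) (fst ih))) \<le> circuit_depth (C t ih)"
      "circuit_depth (C t ih) \<le> 2 * hamming_weight (the (slt_a (Q t) (fst ih)))"
      by linarith+
  qed
  moreover have "\<forall>t. \<forall>i \<in> dom (slt_a (Q t)). \<forall>h \<in> dom (slt_b (Q t)).
      clifford_circuit (num_qubits (Q t)) (C t (i, h)) \<and>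
      implements_logical_gate (Q t) (C t (i, h)) (logical_phase_gate (LeftSector i h))"
    unfolding C_def fst_conv snd_conv
    using targeted_phase_circuit_clifford[OF bases] targeted_phase_circuit_implements[OF bases]
    by blast
  ultimately show ?thesis
    by blast
qed

end
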